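(* For $(M^0,M^1)\in\mathcal M(\theta_0,\theta_1,\theta_\infty)$ let $x_0=m^0_{11}$, $x_1=m^1_{11}$, $x_2=\mathrm{tr}(M^1M^0)$. (1) For $(\hat M^0,\hat M^1)=e^{-\frac{\pi i}2\theta_\infty\sigma_3}S_2^{-1}(M^0,M^1)S_2e^{\frac{\pi i}2\theta_\infty\sigma_3}$ with $\hat M^j=(\hat m^j_{kl})$ ($j=0,1$), write $\hat x_0=\hat m^0_{22}$, $\hat x_1=\hat m^1_{22}$, $\hat x_2=\mathrm{tr}(\hat M^1\hat M^0)$. Then $(\hat x_0,\hat x_1,\hat x_2)\in\mathbf V_{(\theta_0,\theta_1,-\theta_\infty)}$, $(e^{-\pi i\theta_\infty}\hat x_1,e^{-\pi i\theta_\infty}\hat x_0,\hat x_2)\in\mathbf V_{(\theta_0,\theta_1,\theta_\infty)}$, and $$\hat x_0=e^{\pi i\theta_\infty}x_1,\quad\hat x_1=\mathrm{tr}M^1-e^{\pi i\theta_\infty}(x_1x_2+x_0-\mathrm{tr}M^0),\quad\hat x_2=x_2.$$ (2) For $(\check M^0,\check M^1)=e^{\frac{\pi i}2\theta_\infty\sigma_3}S_1(M^0,M^1)S_1^{-1}e^{-\frac{\pi i}2\theta_\infty\sigma_3}$ with $\check M^j=(\check m^j_{kl})$ ($j=0,1$), write $\check x_0=\check m^0_{22}$, $\check x_1=\check m^1_{22}$, $\check x_2=\mathrm{tr}(\check M^1\check M^0)$. Then $(\check x_0,\check x_1,\check x_2)\in\mathbf V_{(\theta_0,\theta_1,-\theta_\infty)}$,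 $(e^{-\pi i\theta_\infty}\check x_1,e^{-\pi i\theta_\infty}\check x_0,\check x_2)\in\mathbf V_{(\theta_0,\theta_1,\theta_\infty)}$, and $$\check x_0=\mathrm{tr}M^0-e^{\pi i\theta_\infty}(x_0x_2+x_1-\mathrm{tr}M^1),\quad\check x_1=e^{\pi i\theta_\infty}x_0,\quad\check x_2=x_2.$$
   Context: $\theta_0,\theta_1,\theta_\infty\in\mathbb{C}$; $\sigma_3=\mathrm{diag}(1,-1)$. $\mathcal M(\theta_0,\theta_1,\theta_\infty)$ is the set of pairs $(M^0,M^1)\in SL_2(\mathbb{C})^2$, $M^0=(m^0_{kl})$, $M^1=(m^1_{kl})$, satisfying $m^0_{11}m^1_{11}+m^0_{21}m^1_{12}=e^{-\pi i\theta_\infty}$, $\mathrm{tr}M^0=2\cos\pi\theta_0$, $\mathrm{tr}M^1=2\cos\pi\theta_1$, modulo $(M^0,M^1)\sim c^{\sigma_3}(M^0,M^1)c^{-\sigma_3}$, $c\in\mathbb{C}\setminus\{0\}$ (here $A(M^0,M^1)A^{-1}$ means $(AM^0A^{-1},AM^1A^{-1})$). The matrices $S_1=\begin{pmatrix}1&0\\ s_1&1\end{pmatrix}$, $S_2=\begin{pmatrix}1&s_2\\ 0&1\end{pmatrix}$ are determined by $M^1M^0=S_1^{-1}e^{-\pi i\theta_\infty\sigma_3}S_2^{-1}$, i.e. $s_2=-e^{\pi i\theta_\infty}(m^0_{12}m^1_{11}+m^0_{22}m^1_{12})$, $s_1=-e^{\pi i\theta_\infty}(m^0_{11}m^1_{21}+m^0_{21}m^1_{22})$.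 The character variety is $$\mathbf V_{(\theta_0,\theta_1,\theta_\infty)}:\ x_0x_1x_2+x_0^2+x_1^2-\mu_0(\theta_\infty)x_0-\mu_1(\theta_\infty)x_1-e^{-\pi i\theta_\infty}x_2+\kappa(\theta_\infty)=0,$$ where, with $T_0=2\cos\pi\theta_0$ $(=\mathrm{tr}M^0)$, $T_1=2\cos\pi\theta_1$ $(=\mathrm{tr}M^1)$, $\mu_0(\theta_\infty)=T_0+e^{-\pi i\theta_\infty}T_1$, $\mu_1(\theta_\infty)=T_1+e^{-\pi i\theta_\infty}T_0$, $\kappa(\theta_\infty)=e^{-2\pi i\theta_\infty}+e^{-\pi i\theta_\infty}T_0T_1+1$; $\mathbf V_{(\theta_0,\theta_1,-\theta_\infty)}$ is obtained by replacing $\theta_\infty$ by $-\theta_\infty$. *)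

theory Defs
  imports "HOL-Analysis.Analysis"
begin

type_synonym cmat2 = "complex^2^2"

definition mat2 :: "complex \<Rightarrow> complex \<Rightarrow> complex \<Rightarrow> complex \<Rightarrow> cmat2" where
  "mat2 a b c d = vector [vector [a, b], vector [c, d]]"

(* c^{\<sigma>_3} = diag(c, 1/c).  In particular e^{z \<sigma>_3} is
   sigma3_pow (exp z) = diag(e^z, e^{-z}), and c^{-\<sigma>_3} is sigma3_pow (inverse c). *)
definition sigma3_pow :: "complex \<Rightarrow> cmat2" where
  "sigma3_pow c = mat2 c 0 0 (inverse c)"

definition pair_sandwich :: "cmat2 \<Rightarrow> cmat2 \<times> cmat2 \<Rightarrow> cmat2 \<Rightarrow> cmat2 \<times> cmat2" where
  "pair_sandwich A P B = (A ** fst P ** B, A ** snd P ** B)"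

definition epi :: "complex \<Rightarrow> complex" where
  "epi t = exp (of_real pi * \<i> * t)"

definition monodromy_pairs :: "complex \<Rightarrow> complex \<Rightarrow> complex \<Rightarrow> (cmat2 \<times> cmat2) set" where
  "monodromy_pairs \<theta>0 \<theta>1 \<theta>inf =
     {(M0, M1). det M0 = 1 \<and> det M1 = 1 \<and>
        M0 $ 1 $ 1 * M1 $ 1 $ 1 + M0 $ 2 $ 1 * M1 $ 1 $ 2 = epi (- \<theta>inf) \<and>
        trace M0 = 2 * cos (of_real pi * \<theta>0) \<and>
        trace M1 = 2 * cos (of_real pi * \<theta>1)}"

(* Every condition defining monodromy_pairs is invariant under c^{\<sigma>_3}-conjugation, so requiring
   it of Q is no restriction: the classes are full orbits. *)
definition diag_conj_rel ::
    "complex \<Rightarrow> complex \<Rightarrow> complex \<Rightarrow> ((cmat2 \<times> cmat2) \<times> (cmat2 \<times> cmat2)) set" where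
  "diag_conj_rel \<theta>0 \<theta>1 \<theta>inf =
     {(P, Q). P \<in> monodromy_pairs \<theta>0 \<theta>1 \<theta>inf \<and> Q \<in> monodromy_pairs \<theta>0 \<theta>1 \<theta>inf \<and>
        (\<exists>c. c \<noteq> 0 \<and> Q = pair_sandwich (sigma3_pow c) P (sigma3_pow (inverse c)))}"

definition monodromy_manifold ::
    "complex \<Rightarrow> complex \<Rightarrow> complex \<Rightarrow> (cmat2 \<times> cmat2) set set" where
  "monodromy_manifold \<theta>0 \<theta>1 \<theta>inf =
     monodromy_pairs \<theta>0 \<theta>1 \<theta>inf // diag_conj_rel \<theta>0 \<theta>1 \<theta>inf"

definition stokes_s1 :: "complex \<Rightarrow> cmat2 \<Rightarrow> cmat2 \<Rightarrow> complex" where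
  "stokes_s1 \<theta>inf M0 M1 =
     - epi \<theta>inf * (M0 $ 1 $ 1 * M1 $ 2 $ 1 + M0 $ 2 $ 1 * M1 $ 2 $ 2)"

definition stokes_s2 :: "complex \<Rightarrow> cmat2 \<Rightarrow> cmat2 \<Rightarrow> complex" where
  "stokes_s2 \<theta>inf M0 M1 =
     - epi \<theta>inf * (M0 $ 1 $ 2 * M1 $ 1 $ 1 + M0 $ 2 $ 2 * M1 $ 1 $ 2)"

definition stokes_S1 :: "complex \<Rightarrow> cmat2 \<Rightarrow> cmat2 \<Rightarrow> cmat2" where
  "stokes_S1 \<theta>inf M0 M1 = mat2 1 0 (stokes_s1 \<theta>inf M0 M1) 1"

definition stokes_S2 :: "complex \<Rightarrow> cmat2 \<Rightarrow> cmat2 \<Rightarrow> cmat2" where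
  "stokes_S2 \<theta>inf M0 M1 = mat2 1 (stokes_s2 \<theta>inf M0 M1) 0 1"

definition char_variety :: "complex \<Rightarrow> complex \<Rightarrow> complex \<Rightarrow> (complex \<times> complex \<times> complex) set" where
  "char_variety \<theta>0 \<theta>1 \<theta>inf =
     {(x0, x1, x2).
        (let T0 = 2 * cos (of_real pi * \<theta>0);
             T1 = 2 * cos (of_real pi * \<theta>1);
             \<mu>0 = T0 + epi (- \<theta>inf) * T1;
             \<mu>1 = T1 + epi (- \<theta>inf) * T0;
             \<kappa> = epi (- 2 * \<theta>inf) + epi (- \<theta>inf) * T0 * T1 + 1
         in x0 * x1 * x2 + x0\<^sup>2 + x1\<^sup>2 - \<mu>0 * x0 - \<mu>1 * x1 - epi (- \<theta>inf) * x2 + \<kappa> = 0)}"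

lemma mat2_nth [simp]:
  "mat2 a b c d $ 1 $ 1 = a" "mat2 a b c d $ 1 $ 2 = b"
  "mat2 a b c d $ 2 $ 1 = c" "mat2 a b c d $ 2 $ 2 = d"
  by (simp_all add: mat2_def)

lemma cmat2_eq_iff:
  fixes A B :: cmat2
  shows "A = B \<longleftrightarrow> A $ 1 $ 1 = B $ 1 $ 1 \<and> A $ 1 $ 2 = B $ 1 $ 2 \<and>
                   A $ 2 $ 1 = B $ 2 $ 1 \<and> A $ 2 $ 2 = B $ 2 $ 2"
  by (auto simp: vec_eq_iff forall_2)

lemma cmat2_mult_nth:
  fixes A B :: cmat2
  shows "(A ** B) $ i $ j = A $ i $ 1 * B $ 1 $ j + A $ i $ 2 * B $ 2 $ j"
  by (simp add: matrix_matrix_mult_def sum_2)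

lemma sigma3_pow_mult: "sigma3_pow c ** sigma3_pow d = sigma3_pow (c * d)"
  by (simp add: cmat2_eq_iff cmat2_mult_nth sigma3_pow_def)

lemma sigma3_pow_1: "sigma3_pow 1 = mat 1"
  by (simp add: cmat2_eq_iff sigma3_pow_def mat_def)

lemma pair_sandwich_twice:
  "pair_sandwich A (pair_sandwich B P C) D = pair_sandwich (A ** B) P (C ** D)"
  by (simp add: pair_sandwich_def matrix_mul_assoc)

lemma equiv_diag_conj_rel:
  "equiv (monodromy_pairs \<theta>0 \<theta>1 \<theta>inf) (diag_conj_rel \<theta>0 \<theta>1 \<theta>inf)"
proof (rule equivI)
  show "diag_conj_rel \<theta>0 \<theta>1 \<theta>inf \<subseteq>
          monodromy_pairs \<theta>0 \<theta>1 \<theta>inf \<times> monodromy_pairs \<theta>0 \<theta>1 \<theta>inf"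
    by (auto simp: diag_conj_rel_def)
  show "refl_on (monodromy_pairs \<theta>0 \<theta>1 \<theta>inf) (diag_conj_rel \<theta>0 \<theta>1 \<theta>inf)"
    by (auto simp: refl_on_def diag_conj_rel_def pair_sandwich_def sigma3_pow_1 intro!: exI[of _ 1])
  show "sym (diag_conj_rel \<theta>0 \<theta>1 \<theta>inf)"
  proof (rule symI)
    fix P Q assume "(P, Q) \<in> diag_conj_rel \<theta>0 \<theta>1 \<theta>inf"
    then obtain c where c: "c \<noteq> 0" "Q = pair_sandwich (sigma3_pow c) P (sigma3_pow (inverse c))"
      and PQ: "P \<in> monodromy_pairs \<theta>0 \<theta>1 \<theta>inf" "Q \<in> monodromy_pairs \<theta>0 \<theta>1 \<theta>inf"
      by (auto simp: diag_conj_rel_def)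
    then have "P = pair_sandwich (sigma3_pow (inverse c)) Q (sigma3_pow (inverse (inverse c)))"
      by (simp add: pair_sandwich_twice sigma3_pow_mult sigma3_pow_1)
         (simp add: pair_sandwich_def)
    with c PQ show "(Q, P) \<in> diag_conj_rel \<theta>0 \<theta>1 \<theta>inf"
      unfolding diag_conj_rel_def by (auto intro!: exI[of _ "inverse c"])
  qed
  show "trans (diag_conj_rel \<theta>0 \<theta>1 \<theta>inf)"
  proof (rule transI)
    fix P Q R
    assume "(P, Q) \<in> diag_conj_rel \<theta>0 \<theta>1 \<theta>inf" "(Q, R) \<in> diag_conj_rel \<theta>0 \<theta>1 \<theta>inf"
    then obtain c d where cd: "c \<noteq> 0" "d \<noteq> 0"
        "Q = pair_sandwich (sigma3_pow c) P (sigma3_pow (inverse c))"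
        "R = pair_sandwich (sigma3_pow d) Q (sigma3_pow (inverse d))"
      and PR: "P \<in> monodromy_pairs \<theta>0 \<theta>1 \<theta>inf" "R \<in> monodromy_pairs \<theta>0 \<theta>1 \<theta>inf"
      by (auto simp: diag_conj_rel_def)
    then have "R = pair_sandwich (sigma3_pow (d * c)) P (sigma3_pow (inverse (d * c)))"
      by (simp add: pair_sandwich_twice sigma3_pow_mult mult.commute)
    with cd PR show "(P, R) \<in> diag_conj_rel \<theta>0 \<theta>1 \<theta>inf"
      unfolding diag_conj_rel_def by (auto intro!: exI[of _ "d * c"])
  qed
qed

lemma matrix_inv_eqI:
  fixes A B :: cmat2
  assumes "A ** B = mat 1" "B ** A = mat 1"
  shows "matrix_inv A = B"
proof -
  have "A ** matrix_inv A = mat 1 \<and> matrix_inv A ** A = mat 1"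
    unfolding matrix_inv_def by (rule someI[of _ B]) (use assms in simp)
  then show ?thesis
    by (metis assms(2) matrix_mul_assoc matrix_mul_lid matrix_mul_rid)
qed

lemma matrix_inv_unipotent:
  "matrix_inv (mat2 1 0 s 1) = mat2 1 0 (- s) 1"
  "matrix_inv (mat2 1 s 0 1) = mat2 1 (- s) 0 1"
  by (rule matrix_inv_eqI; simp add: cmat2_eq_iff cmat2_mult_nth mat_def)+

(* The closed formulas for s_1, s_2 are equivalent to the defining factorization
   M^1 M^0 = S_1^{-1} e^{-\<pi> i \<theta>inf \<sigma>_3} S_2^{-1}. *)
lemma stokes_factorization_iff:
  assumes "(M0, M1) \<in> monodromy_pairs \<theta>0 \<theta>1 \<theta>inf"
  shows "M1 ** M0 = matrix_inv (mat2 1 0 s1 1) ** sigma3_pow (epi (- \<theta>inf)) ** matrix_inv (mat2 1 s2 0 1)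
         \<longleftrightarrow> s1 = stokes_s1 \<theta>inf M0 M1 \<and> s2 = stokes_s2 \<theta>inf M0 M1"
    (is "?L \<longleftrightarrow> ?R")
proof -
  define e where "e = epi \<theta>inf"
  have e: "e \<noteq> 0" "epi (- \<theta>inf) = inverse e"
    by (simp_all add: e_def epi_def exp_minus)
  define N where "N = M1 ** M0"
  have N11: "N $ 1 $ 1 = inverse e"
    using assms e by (simp add: monodromy_pairs_def N_def cmat2_mult_nth mult.commute)
  have "det N = 1"
    using assms by (simp add: monodromy_pairs_def N_def det_mul)
  then have "inverse e * N $ 2 $ 2 - N $ 1 $ 2 * N $ 2 $ 1 = 1"
    by (simp add: det_2 N11)
  then have N22: "N $ 2 $ 2 = e * (1 + N $ 1 $ 2 * N $ 2 $ 1)"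
    using e(1) by (simp add: field_simps)
  have R: "?R \<longleftrightarrow> s1 = - e * N $ 2 $ 1 \<and> s2 = - e * N $ 1 $ 2"
    by (simp add: stokes_s1_def stokes_s2_def N_def cmat2_mult_nth e_def mult.commute)
  have L: "?L \<longleftrightarrow> N $ 1 $ 2 = - s2 * inverse e \<and> N $ 2 $ 1 = - s1 * inverse e \<and>
                 N $ 2 $ 2 = s1 * s2 * inverse e + e"
    unfolding N_def[symmetric] cmat2_eq_iff[of N]
    by (simp add: matrix_inv_unipotent e cmat2_mult_nth sigma3_pow_def N11 mult_ac)
  show ?thesis
    unfolding L R N22 using e(1) by (auto simp: field_simps)
qed

end

theory Submission
  imports Defs
begin

text \<open>
  The surface equation is quadratic in each of \<open>x\<^sub>0\<close> and \<open>x\<^sub>1\<close>. Conjugation by \<open>S\<^sub>2\<close> realises the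
  Vieta involution replacing \<open>x\<^sub>0\<close> by the other root, and conjugation by \<open>S\<^sub>1\<close> the one replacing
  \<open>x\<^sub>1\<close>. Reading off the (2,2) entries instead of the (1,1) entries amounts to swapping the first
  two coordinates and scaling them by \<open>e\<^bsup>\<pi>i\<theta>\<infinity>\<^esup>\<close>, which maps the surface for \<open>\<theta>\<infinity>\<close> to the one
  for \<open>-\<theta>\<infinity>\<close>.
\<close>

lemma epi_minus: "epi (- t) = inverse (epi t)"
  by (simp add: epi_def exp_minus)

lemma epi_nonzero [simp]: "epi t \<noteq> 0"
  by (simp add: epi_def)

lemma epi_minus_double: "epi (- 2 * t) = (epi (- t))\<^sup>2"
  by (simp add: epi_def power2_eq_square mult_ac flip: exp_add)

text \<open>With \<open>E = epi (- \<theta>inf)\<close>, substituting the swapped and scaled point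
  into the polynomial for \<open>\<theta>inf\<close> gives \<open>E\<^sup>2\<close> times the
  polynomial for \<open>- \<theta>inf\<close>, and \<open>E\<close> is nonzero.\<close>

lemma char_variety_swap_scale:
  "(y0, y1, y2) \<in> char_variety \<theta>0 \<theta>1 (- \<theta>inf) \<longleftrightarrow>
   (epi (- \<theta>inf) * y1, epi (- \<theta>inf) * y0, y2) \<in> char_variety \<theta>0 \<theta>1 \<theta>inf"
proof -
  define E where "E = epi (- \<theta>inf)"
  define e where "e = epi \<theta>inf"
  define T0 where "T0 = 2 * cos (of_real pi * \<theta>0)"
  define T1 where "T1 = 2 * cos (of_real pi * \<theta>1)"
  have eE: "e * E = 1" and "E \<noteq> 0"
    by (simp_all add: e_def E_def epi_minus)
  \<comment> \<open>\<open>p\<close> is the surface polynomial for \<open>- \<theta>inf\<close>,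
    where \<open>e\<close> takes the place of \<open>E\<close>; \<open>q\<close> is the one for
    \<open>\<theta>inf\<close> at the transformed point.\<close>
  define p where "p = y0 * y1 * y2 + y0\<^sup>2 + y1\<^sup>2 - (T0 + e * T1) * y0 - (T1 + e * T0) * y1
    - e * y2 + (e\<^sup>2 + e * T0 * T1 + 1)"
  define q where "q = (E * y1) * (E * y0) * y2 + (E * y1)\<^sup>2 + (E * y0)\<^sup>2
    - (T0 + E * T1) * (E * y1) - (T1 + E * T0) * (E * y0) - E * y2 + (E\<^sup>2 + E * T0 * T1 + 1)"
  have "q = E\<^sup>2 * p"
    using eE unfolding p_def q_def by algebra
  with \<open>E \<noteq> 0\<close> have "p = 0 \<longleftrightarrow> q = 0"
    by simp
  moreover have "epi (2 * \<theta>inf) = e\<^sup>2"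
    using epi_minus_double[of "- \<theta>inf"] by (simp add: e_def)
  ultimately show ?thesis
    using epi_minus_double[of \<theta>inf]
    by (simp add: char_variety_def Let_def p_def q_def T0_def T1_def E_def e_def)
qed

text \<open>The equation is monic in \<open>x0\<close> with linear coefficient
  \<open>x1 * x2 - \<mu>0\<close>, so the two roots add up to \<open>\<mu>0 - x1 * x2\<close>;
  likewise for \<open>x1\<close> with \<open>\<mu>1\<close>.\<close>

lemma char_variety_vieta:
  assumes "(x0, x1, x2) \<in> char_variety \<theta>0 \<theta>1 \<theta>inf"
  defines "T0 \<equiv> 2 * cos (of_real pi * \<theta>0)" and "T1 \<equiv> 2 * cos (of_real pi * \<theta>1)"
  shows "(T0 + epi (- \<theta>inf) * T1 - x1 * x2 - x0, x1, x2) \<in> char_variety \<theta>0 \<theta>1 \<theta>inf"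
    and "(x0, T1 + epi (- \<theta>inf) * T0 - x0 * x2 - x1, x2) \<in> char_variety \<theta>0 \<theta>1 \<theta>inf"
  using assms(1) unfolding char_variety_def Let_def mem_Collect_eq prod.case
    T0_def[symmetric] T1_def[symmetric]
  by algebra+

lemma monodromy_coordinates_in_char_variety:
  assumes "(M0, M1) \<in> monodromy_pairs \<theta>0 \<theta>1 \<theta>inf"
  shows "(M0 $ 1 $ 1, M1 $ 1 $ 1, trace (M1 ** M0)) \<in> char_variety \<theta>0 \<theta>1 \<theta>inf"
proof -
  have T: "2 * cos (of_real pi * \<theta>0) = M0 $ 1 $ 1 + M0 $ 2 $ 2"
    "2 * cos (of_real pi * \<theta>1) = M1 $ 1 $ 1 + M1 $ 2 $ 2"
    using assms by (simp_all add: monodromy_pairs_def trace_def sum_2)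
  have D: "M0 $ 1 $ 1 * M0 $ 2 $ 2 - M0 $ 1 $ 2 * M0 $ 2 $ 1 = 1"
    "M1 $ 1 $ 1 * M1 $ 2 $ 2 - M1 $ 1 $ 2 * M1 $ 2 $ 1 = 1"
    using assms by (simp_all add: monodromy_pairs_def det_2)
  have E: "epi (- \<theta>inf) = M0 $ 1 $ 1 * M1 $ 1 $ 1 + M0 $ 2 $ 1 * M1 $ 1 $ 2"
    using assms by (simp add: monodromy_pairs_def)
  show ?thesis
    \<comment> \<open>Write a, b, c, d for the entries of \<open>M0\<close> and a', b', c', d' for
      those of \<open>M1\<close>, row by row. After the substitutions the left side collapses to (ad
      - 1)(a'd' - 1) - bcb'c', which vanishes by \<open>D\<close>.\<close>
    unfolding char_variety_def Let_def mem_Collect_eq prod.case T epi_minus_double E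
      trace_def sum_2 cmat2_mult_nth
    using D by algebra
qed

lemma trace_mult_conjugates:
  fixes A B X Y :: "'a::comm_semiring_1^'n^'n"
  assumes "B ** A = mat 1"
  shows "trace ((A ** X ** B) ** (A ** Y ** B)) = trace (X ** Y)"
proof -
  have "(A ** X ** B) ** (A ** Y ** B) = A ** X ** (B ** A) ** Y ** B"
    by (simp only: matrix_mul_assoc)
  also have "trace \<dots> = trace (B ** (A ** X ** Y))"
    by (simp add: assms trace_mul_sym[of _ B])
  also have "B ** (A ** X ** Y) = (B ** A) ** X ** Y"
    by (simp only: matrix_mul_assoc)
  finally show ?thesis
    by (simp add: assms)
qed

text \<open>Diagonal conjugation fixes the diagonal entries, so only the shear contributes.\<close>

lemma upper_conjugate_22:
  fixes M :: cmat2
  assumes "t \<noteq> 0"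
  shows "((sigma3_pow (inverse t) ** mat2 1 (- s) 0 1) ** M ** (mat2 1 s 0 1 ** sigma3_pow t)) $ 2 $ 2
    = M $ 2 $ 2 + s * M $ 2 $ 1"
  using assms by (simp add: cmat2_mult_nth sigma3_pow_def field_simps)

lemma lower_conjugate_22:
  fixes M :: cmat2
  assumes "t \<noteq> 0"
  shows "((sigma3_pow t ** mat2 1 0 s 1) ** M ** (mat2 1 0 (- s) 1 ** sigma3_pow (inverse t))) $ 2 $ 2
    = M $ 2 $ 2 + s * M $ 1 $ 2"
  using assms by (simp add: cmat2_mult_nth sigma3_pow_def field_simps)

theorem theorem2p18:
  fixes \<theta>0 \<theta>1 \<theta>inf :: complex
    and \<C> :: "(cmat2 \<times> cmat2) set"
    and M0 M1 :: cmat2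
  assumes "\<C> \<in> monodromy_manifold \<theta>0 \<theta>1 \<theta>inf"
    and "(M0, M1) \<in> \<C>"
  shows
    "let x0 = M0 $ 1 $ 1; x1 = M1 $ 1 $ 1; x2 = trace (M1 ** M0);
         S1 = stokes_S1 \<theta>inf M0 M1; S2 = stokes_S2 \<theta>inf M0 M1
     in
      (let (N0, N1) = pair_sandwich (sigma3_pow (epi (- \<theta>inf / 2)) ** matrix_inv S2)
                        (M0, M1) (S2 ** sigma3_pow (epi (\<theta>inf / 2)));
           y0 = N0 $ 2 $ 2; y1 = N1 $ 2 $ 2; y2 = trace (N1 ** N0)
       in (y0, y1, y2) \<in> char_variety \<theta>0 \<theta>1 (- \<theta>inf) \<and>
          (epi (- \<theta>inf) * y1, epi (- \<theta>inf) * y0, y2) \<in> char_variety \<theta>0 \<theta>1 \<theta>inf \<and>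
          y0 = epi \<theta>inf * x1 \<and>
          y1 = trace M1 - epi \<theta>inf * (x1 * x2 + x0 - trace M0) \<and>
          y2 = x2) \<and>
      (let (N0, N1) = pair_sandwich (sigma3_pow (epi (\<theta>inf / 2)) ** S1)
                        (M0, M1) (matrix_inv S1 ** sigma3_pow (epi (- \<theta>inf / 2)));
           y0 = N0 $ 2 $ 2; y1 = N1 $ 2 $ 2; y2 = trace (N1 ** N0)
       in (y0, y1, y2) \<in> char_variety \<theta>0 \<theta>1 (- \<theta>inf) \<and>
          (epi (- \<theta>inf) * y1, epi (- \<theta>inf) * y0, y2) \<in> char_variety \<theta>0 \<theta>1 \<theta>inf \<and>
          y0 = trace M0 - epi \<theta>inf * (x0 * x2 + x1 - trace M1) \<and>
          y1 = epi \<theta>inf * x0 \<and>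
          y2 = x2)"
proof -
  \<comment> \<open>A class is a subset of the set of pairs, so any representative may be
    used.\<close>
  have "(M0, M1) \<in> monodromy_pairs \<theta>0 \<theta>1 \<theta>inf"
    using assms in_quotient_imp_subset[OF equiv_diag_conj_rel] unfolding monodromy_manifold_def by blast
  note V = monodromy_coordinates_in_char_variety[OF this]
  define e where "e = epi \<theta>inf"
  define t where "t = epi (\<theta>inf / 2)"
  define x2 where "x2 = trace (M1 ** M0)"
  have T: "2 * cos (of_real pi * \<theta>0) = trace M0" "2 * cos (of_real pi * \<theta>1) = trace M1"
    and D: "M0 $ 1 $ 1 * M0 $ 2 $ 2 - M0 $ 1 $ 2 * M0 $ 2 $ 1 = 1"
      "M1 $ 1 $ 1 * M1 $ 2 $ 2 - M1 $ 1 $ 2 * M1 $ 2 $ 1 = 1"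
    and E: "e * (M0 $ 1 $ 1 * M1 $ 1 $ 1 + M0 $ 2 $ 1 * M1 $ 1 $ 2) = 1"
    using \<open>(M0, M1) \<in> monodromy_pairs \<theta>0 \<theta>1 \<theta>inf\<close>
    by (simp_all add: monodromy_pairs_def det_2 e_def epi_minus)
  have t: "t \<noteq> 0" "epi (- \<theta>inf / 2) = inverse t"
    by (simp_all add: t_def flip: epi_minus)
  have e: "epi (- \<theta>inf) * e = 1"
    by (simp add: e_def epi_minus)
  have tr: "trace M0 = M0 $ 1 $ 1 + M0 $ 2 $ 2" "trace M1 = M1 $ 1 $ 1 + M1 $ 2 $ 2"
    "x2 = M1 $ 1 $ 1 * M0 $ 1 $ 1 + M1 $ 1 $ 2 * M0 $ 2 $ 1
      + (M1 $ 2 $ 1 * M0 $ 1 $ 2 + M1 $ 2 $ 2 * M0 $ 2 $ 2)"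
    by (simp_all add: trace_def sum_2 cmat2_mult_nth x2_def)

  define s2 where "s2 = stokes_s2 \<theta>inf M0 M1"
  define A2 where "A2 = sigma3_pow (inverse t) ** mat2 1 (- s2) 0 1"
  define B2 where "B2 = mat2 1 s2 0 1 ** sigma3_pow t"
  have AB2: "B2 ** A2 = mat 1"
    using t by (simp add: A2_def B2_def cmat2_eq_iff cmat2_mult_nth sigma3_pow_def mat_def)
  have s2: "s2 = - e * (M0 $ 1 $ 2 * M1 $ 1 $ 1 + M0 $ 2 $ 2 * M1 $ 1 $ 2)"
    by (simp add: s2_def stokes_s2_def e_def)
  \<comment> \<open>By \<open>E\<close>, 1 - ecb' = eaa', so d + \<open>s2\<close> c = ea'(ad - bc)
    = ea'.\<close>
  have hat0: "(A2 ** M0 ** B2) $ 2 $ 2 = e * M1 $ 1 $ 1"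
    unfolding A2_def B2_def upper_conjugate_22[OF t(1)] s2 using D E by algebra
  \<comment> \<open>By \<open>E\<close>, e\<open>x2\<close> = 1 + e(bc' + dd'); the rest follows
    from a'd' - 1 = b'c'.\<close>
  have hat1: "(A2 ** M1 ** B2) $ 2 $ 2 = trace M1 - e * (M1 $ 1 $ 1 * x2 + M0 $ 1 $ 1 - trace M0)"
    unfolding A2_def B2_def upper_conjugate_22[OF t(1)] s2 tr using D E by algebra
  \<comment> \<open>Scaling back gives exactly the Vieta partner of the original point in its first
    coordinate.\<close>
  have "epi (- \<theta>inf) * (e * M1 $ 1 $ 1) = M1 $ 1 $ 1"
    "epi (- \<theta>inf) * (trace M1 - e * (M1 $ 1 $ 1 * x2 + M0 $ 1 $ 1 - trace M0))
      = trace M0 + epi (- \<theta>inf) * trace M1 - M1 $ 1 $ 1 * x2 - M0 $ 1 $ 1"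
    using e by algebra+
  then have hatV: "(epi (- \<theta>inf) * (A2 ** M1 ** B2) $ 2 $ 2, epi (- \<theta>inf) * (A2 ** M0 ** B2) $ 2 $ 2, x2)
      \<in> char_variety \<theta>0 \<theta>1 \<theta>inf"
    using char_variety_vieta(1)[OF V] by (simp only: hat0 hat1 T x2_def)

  define s1 where "s1 = stokes_s1 \<theta>inf M0 M1"
  define A1 where "A1 = sigma3_pow t ** mat2 1 0 s1 1"
  define B1 where "B1 = mat2 1 0 (- s1) 1 ** sigma3_pow (inverse t)"
  have AB1: "B1 ** A1 = mat 1"
    using t by (simp add: A1_def B1_def cmat2_eq_iff cmat2_mult_nth sigma3_pow_def mat_def)
  have s1: "s1 = - e * (M0 $ 1 $ 1 * M1 $ 2 $ 1 + M0 $ 2 $ 1 * M1 $ 2 $ 2)"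
    by (simp add: s1_def stokes_s1_def e_def)
  \<comment> \<open>Mirror image of \<open>hat0\<close>: d' + \<open>s1\<close> b' = ea(a'd' - b'c')
    = ea.\<close>
  have check1: "(A1 ** M1 ** B1) $ 2 $ 2 = e * M0 $ 1 $ 1"
    unfolding A1_def B1_def lower_conjugate_22[OF t(1)] s1 using D E by algebra
  have check0: "(A1 ** M0 ** B1) $ 2 $ 2 = trace M0 - e * (M0 $ 1 $ 1 * x2 + M1 $ 1 $ 1 - trace M1)"
    unfolding A1_def B1_def lower_conjugate_22[OF t(1)] s1 tr using D E by algebra
  \<comment> \<open>This time the second coordinate is replaced by its Vieta partner.\<close>
  have "epi (- \<theta>inf) * (e * M0 $ 1 $ 1) = M0 $ 1 $ 1"
    "epi (- \<theta>inf) * (trace M0 - e * (M0 $ 1 $ 1 * x2 + M1 $ 1 $ 1 - trace M1))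
      = trace M1 + epi (- \<theta>inf) * trace M0 - M0 $ 1 $ 1 * x2 - M1 $ 1 $ 1"
    using e by algebra+
  then have checkV: "(epi (- \<theta>inf) * (A1 ** M1 ** B1) $ 2 $ 2, epi (- \<theta>inf) * (A1 ** M0 ** B1) $ 2 $ 2, x2)
      \<in> char_variety \<theta>0 \<theta>1 \<theta>inf"
    using char_variety_vieta(2)[OF V] by (simp only: check0 check1 T x2_def)

  have P2: "pair_sandwich (sigma3_pow (epi (- \<theta>inf / 2)) ** matrix_inv (stokes_S2 \<theta>inf M0 M1))
      (M0, M1) (stokes_S2 \<theta>inf M0 M1 ** sigma3_pow (epi (\<theta>inf / 2)))
      = (A2 ** M0 ** B2, A2 ** M1 ** B2)"
    by (simp only: pair_sandwich_def fst_conv snd_conv stokes_S2_def matrix_inv_unipotent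
        t(2) t_def[symmetric] s2_def[symmetric] A2_def[symmetric] B2_def[symmetric])
  have P1: "pair_sandwich (sigma3_pow (epi (\<theta>inf / 2)) ** stokes_S1 \<theta>inf M0 M1)
      (M0, M1) (matrix_inv (stokes_S1 \<theta>inf M0 M1) ** sigma3_pow (epi (- \<theta>inf / 2)))
      = (A1 ** M0 ** B1, A1 ** M1 ** B1)"
    by (simp only: pair_sandwich_def fst_conv snd_conv stokes_S1_def matrix_inv_unipotent
        t(2) t_def[symmetric] s1_def[symmetric] A1_def[symmetric] B1_def[symmetric])
  show ?thesis
    \<comment> \<open>The swap equivalence turns each membership for \<open>- \<theta>inf\<close>
      into the one for \<open>\<theta>inf\<close>, so \<open>hatV\<close> and \<open>checkV\<close>
      each settle two conjuncts.\<close>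
    unfolding Let_def P1 P2 prod.case trace_mult_conjugates[OF AB1] trace_mult_conjugates[OF AB2]
      x2_def[symmetric] e_def[symmetric] char_variety_swap_scale[of _ _ _ _ _ \<theta>inf]
    by (intro conjI hatV checkV hat0 hat1 check0 check1 refl)
qed

end
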